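(* There exists a function $h\in BMO(\mathbb{R}^2)$ such that none of its horizontal slices is in $BMO(\mathbb{R})$; that is, for every $y\in\mathbb{R}$ the function $h_y(x)=h(x,y)$ does not belong to $BMO(\mathbb{R})$.
   Context: For a locally integrable function $g$ on $\mathbb{R}^d$ and a measurable set $A\subset\mathbb{R}^d$ of positive finite measure, $g_A=\frac{1}{|A|}\int_A g$ and $O(g,A)=\frac{1}{|A|}\int_A|g-g_A|$. $BMO(\mathbb{R}^d)$ is the space of $g\in L^1_{loc}(\mathbb{R}^d)$ with $\|g\|_{BMO(\mathbb{R}^d)}=\sup_Q O(g,Q)<\infty$, the supremum over all closed cubes $Q$ with sides parallel to the axes (intervals when $d=1$, squares when $d=2$). *)

theory Defs
  imports "HOL-Analysis.Analysis"
begin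

text \<open>Functions are real-valued, defined everywhere and Lebesgue measurable; they are not
  identified up to null sets, so that restricting to a line makes sense.\<close>

definition locally_integrable :: "('a::euclidean_space \<Rightarrow> real) \<Rightarrow> bool" where
  "locally_integrable g \<longleftrightarrow> (\<forall>K. compact K \<longrightarrow> set_integrable lebesgue K g)"

definition average :: "('a::euclidean_space \<Rightarrow> real) \<Rightarrow> 'a set \<Rightarrow> real" where
  "average g A = (LINT x:A|lebesgue. g x) / measure lebesgue A"

definition mean_oscillation :: "('a::euclidean_space \<Rightarrow> real) \<Rightarrow> 'a set \<Rightarrow> real" where
  "mean_oscillation g A = average (\<lambda>x. \<bar>g x - average g A\<bar>) A"

text \<open>\<open>One\<close> is the sum of the standard basis vectors, so \<open>l\<close> is the common side length.\<close>

definition closed_cubes :: "'a::euclidean_space set set" where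
  "closed_cubes = {cbox a (a + l *\<^sub>R One) | a l. l > 0}"

definition bmo_norm :: "('a::euclidean_space \<Rightarrow> real) \<Rightarrow> ereal" where
  "bmo_norm g = (SUP Q\<in>closed_cubes. ereal (mean_oscillation g Q))"

definition BMO :: "('a::euclidean_space \<Rightarrow> real) set" where
  "BMO = {g. locally_integrable g \<and> bmo_norm g < \<infinity>}"

end

theory Submission
  imports Defs "HOL-Real_Asymp.Real_Asymp"
begin

text \<open>
  The function \<open>L y = max 0 (ln (1 / \<bar>y\<bar>))\<close> is unbounded but has bounded mean oscillation on the line,
  and it keeps bounded mean oscillation when multiplied by a bounded Lipschitz function:
  the extra term on an interval of length \<open>t\<close> is at most \<open>t\<close> times the size of an average of
  \<open>L\<close>, that is about \<open>t * ln (1 / t)\<close>. Let \<open>arch\<close> be a Lipschitz function vanishing exactly at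
  the integers, and let \<open>q\<close> map the integers onto a dense set of reals. The witness is
  \<open>h (x, y) = arch x * L (y - q \<lfloor>x\<rfloor>)\<close>: above each interval \<open>[n, n + 1]\<close> it has a logarithmic ridge
  along the horizontal segment at height \<open>q n\<close>, and it vanishes between neighbouring strips.

  The slice of \<open>h\<close> at height \<open>y\<close> is on \<open>[n, n + 1]\<close> the fixed profile \<open>arch\<close> multiplied by
  \<open>L (y - q n)\<close>, so its oscillation there is a positive constant times \<open>L (y - q n)\<close>
  (\<open>mean_oscillation_ridges_slice\<close>). As \<open>q\<close> has dense range, \<open>y - q n\<close> becomes arbitrarily small
  without being zero, and no slice is in \<open>BMO\<close> (\<open>ridges_slice_not_BMO\<close>).

  In the plane, take a square of side \<open>t\<close> and compare \<open>L\<close> with its truncation at distance \<open>t\<close> from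
  the pole. The truncation varies by at most 1 over the square, and the difference
  \<open>log_excess t\<close> has integral at most \<open>2 * t\<close> over the line. This yields
  \<open>\<bar>h (x, y) - c\<bar> \<le> 2 + log_excess t (y - q \<lfloor>x\<rfloor>)\<close> on the square for a suitable constant \<open>c\<close>
  (\<open>ridges_pointwise\<close>), with \<open>c = 0\<close> when the square meets two strips, because then \<open>arch\<close> is at most
  \<open>t\<close> on it. Integrating bounds every mean oscillation by the same number
  (\<open>mean_oscillation_ridges\<close>).
\<close>

section \<open>Mean oscillation around an arbitrary constant\<close>

text \<open>The average is within a factor 2 of the best constant, since its distance to \<open>c\<close> is itself at
  most the mean of \<open>\<bar>g - c\<bar>\<close>. Upper bounds may thus use any convenient \<open>c\<close>.\<close>

lemma mean_oscillation_le:
  fixes g :: "'a::euclidean_space \<Rightarrow> real"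
  assumes g: "set_integrable lebesgue A g" and A: "A \<in> lmeasurable"
    and pos: "measure lebesgue A > 0"
  shows "mean_oscillation g A \<le> 2 * average (\<lambda>x. \<bar>g x - c\<bar>) A"
proof -
  define m where "m = measure lebesgue A"
  define d where "d = average g A"
  have const: "set_integrable lebesgue A (\<lambda>x. k)" for k :: real
    using A by (simp add: set_integrable_def lmeasurable_iff_integrable)
  have int_const: "(LINT x:A|lebesgue. k) = k * m" for k :: real
    using A by (simp add: set_lebesgue_integral_def m_def lmeasurable_iff_integrable)
  have gc: "set_integrable lebesgue A (\<lambda>x. g x - k)" for k
    by (intro set_integral_diff g const)
  have gabs: "set_integrable lebesgue A (\<lambda>x. \<bar>g x - k\<bar>)" for k
    by (intro set_integrable_abs gc)
  have "(LINT x:A|lebesgue. g x - c) = d * m - c * m"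
    using pos by (simp add: set_integral_diff g const int_const d_def average_def m_def)
  then have "(d - c) * m = (LINT x:A|lebesgue. g x - c)" by (simp add: algebra_simps)
  then have "\<bar>d - c\<bar> * m = \<bar>LINT x:A|lebesgue. g x - c\<bar>"
    using pos by (metis abs_mult abs_of_pos m_def)
  also have "\<dots> \<le> (LINT x:A|lebesgue. \<bar>g x - c\<bar>)"
    using set_integral_norm_bound[OF gc] by simp
  finally have dc: "\<bar>d - c\<bar> * m \<le> (LINT x:A|lebesgue. \<bar>g x - c\<bar>)" .
  have "(LINT x:A|lebesgue. \<bar>g x - d\<bar>) \<le> (LINT x:A|lebesgue. \<bar>g x - c\<bar> + \<bar>d - c\<bar>)"
    by (intro set_integral_mono gabs set_integral_add const) auto
  also have "\<dots> = (LINT x:A|lebesgue. \<bar>g x - c\<bar>) + \<bar>d - c\<bar> * m"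
    by (simp add: set_integral_add gabs const int_const)
  also have "\<dots> \<le> 2 * (LINT x:A|lebesgue. \<bar>g x - c\<bar>)" using dc by simp
  finally show ?thesis
    using pos by (simp add: mean_oscillation_def average_def d_def divide_right_mono)
qed

section \<open>The truncated logarithm\<close>

text \<open>For \<open>t > 0\<close> the pole of \<open>max 0 (ln (1 / \<bar>y\<bar>))\<close> is cut off at distance \<open>t\<close>; for \<open>t = 0\<close> nothing is
  cut off, and \<open>ln 0 = 0\<close> gives the value 0 at the pole.\<close>

definition truncated_log :: "real \<Rightarrow> real \<Rightarrow> real" where
  "truncated_log t y = - ln (min 1 (max \<bar>y\<bar> t))"

definition log_excess :: "real \<Rightarrow> real \<Rightarrow> real" where
  "log_excess t y = \<bar>truncated_log 0 y - truncated_log t y\<bar>"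

lemma truncated_log_nonneg: "t \<ge> 0 \<Longrightarrow> truncated_log t y \<ge> 0"
proof (cases "min 1 (max \<bar>y\<bar> t) > 0")
  case True
  then have "ln (min 1 (max \<bar>y\<bar> t)) \<le> ln 1" by (subst ln_le_cancel_iff) auto
  then show ?thesis by (simp only: truncated_log_def ln_one)
next
  case False
  moreover assume "t \<ge> 0"
  ultimately have "min 1 (max \<bar>y\<bar> t) = 0" by linarith
  then show ?thesis by (simp only: truncated_log_def ln_0)
qed

lemma measurable_truncated_log [measurable]: "truncated_log t \<in> borel_measurable borel"
  unfolding truncated_log_def by measurable

lemma measurable_log_excess [measurable]: "log_excess t \<in> borel_measurable borel"
  unfolding log_excess_def by measurable

text \<open>The logarithm has slope at most \<open>1 / t\<close> beyond distance \<open>t\<close> from the pole, which compensates a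
  displacement of size \<open>t\<close>.\<close>

lemma truncated_log_variation:
  assumes t: "t > 0" and yb: "\<bar>y - b\<bar> \<le> t"
  shows "\<bar>truncated_log t y - truncated_log t b\<bar> \<le> 1"
proof -
  define u where "u = min 1 (max \<bar>y\<bar> t)"
  define v where "v = min 1 (max \<bar>b\<bar> t)"
  have uv: "u > 0" "v > 0" "\<bar>u - v\<bar> \<le> u" "\<bar>u - v\<bar> \<le> v"
    using t yb by (auto simp: u_def v_def min_def max_def)
  have "ln u - ln v \<le> (u - v) / v" "ln v - ln u \<le> (v - u) / u"
    using uv by (auto intro: ln_diff_le)
  moreover have "(u - v) / v \<le> 1" "(v - u) / u \<le> 1" using uv by (auto simp: divide_simps)
  ultimately have "\<bar>ln v - ln u\<bar> \<le> 1" by linarith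
  then show ?thesis by (simp add: truncated_log_def u_def v_def)
qed

text \<open>The logarithm grows so slowly that it stays a bounded multiplier on functions that are
  small of order \<open>t\<close> at scale \<open>t\<close>.\<close>

lemma mult_truncated_log_le:
  assumes "t > 0"
  shows "t * truncated_log t y \<le> 1"
proof -
  define u where "u = min 1 (max \<bar>y\<bar> t)"
  have u: "u > 0" "u \<le> 1" using assms by (auto simp: u_def)
  have l: "- ln u \<le> 1 / u - 1" using ln_le_minus_one[of "1 / u"] u by (simp add: ln_div)
  show ?thesis
  proof (cases "t \<ge> 1")
    case True
    then show ?thesis by (auto simp: truncated_log_def)
  next
    case False
    then have "t \<le> u" by (auto simp: u_def)
    have "t * (- ln u) \<le> u * (- ln u)" using \<open>t \<le> u\<close> u by (intro mult_right_mono) auto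
    also have "\<dots> \<le> u * (1 / u - 1)" using l u by (intro mult_left_mono) auto
    also have "\<dots> \<le> 1" using u by (simp add: algebra_simps)
    finally show ?thesis by (simp add: truncated_log_def u_def)
  qed
qed

text \<open>The primitive \<open>y * (ln s + 1) - y * ln y\<close> extends continuously to 0. The hypothesis leaves \<open>f 0\<close>
  free, as the value of \<open>log_excess\<close> at the pole is not that of the formula.\<close>

lemma has_integral_ln_ratio:
  fixes s :: real
  assumes s: "s > 0"
    and f: "\<And>y. 0 < y \<Longrightarrow> y < s \<Longrightarrow> f y = ln s - ln y"
  shows "(f has_integral s) {0..s}"
proof -
  define F where "F = (\<lambda>y::real. y * (ln s + 1) - y * ln y)"
  have "(F \<longlongrightarrow> F 0) (at_right 0)" unfolding F_def by real_asymp
  then have cont0: "continuous (at 0 within {0..s}) F"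
    using s by (simp add: continuous_within at_within_Icc_at_right)
  have "continuous_on {0..s} F"
    unfolding continuous_on_eq_continuous_within
  proof
    fix y assume y: "y \<in> {0..s}"
    show "continuous (at y within {0..s}) F"
    proof (cases "y = 0")
      case False
      then have "isCont F y" using y unfolding F_def by (intro continuous_intros) auto
      then show ?thesis by (rule continuous_at_imp_continuous_at_within)
    qed (use cont0 in simp)
  qed
  moreover have "(F has_vector_derivative f y) (at y)" if "y \<in> {0<..<s}" for y
    unfolding F_def has_real_derivative_iff_has_vector_derivative[symmetric]
    using that by (auto intro!: derivative_eq_intros simp: f)
  ultimately have "(f has_integral (F s - F 0)) {0..s}"
    using s by (intro fundamental_theorem_of_calculus_interior) auto
  then show ?thesis by (simp add: F_def algebra_simps)
qed

text \<open>The excess is \<open>ln (s / \<bar>y\<bar>)\<close> for \<open>\<bar>y\<bar> < s\<close> and zero elsewhere, where \<open>s = min 1 t\<close>.\<close>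

lemma nn_integral_log_excess:
  assumes t: "t > 0"
  shows "(\<integral>\<^sup>+y. ennreal (log_excess t y) \<partial>lborel) \<le> ennreal (2 * t)"
proof -
  define s where "s = min 1 t"
  have s: "s > 0" "s \<le> 1" "s \<le> t" using t by (auto simp: s_def)
  have outside: "log_excess t y = 0" if "\<bar>y\<bar> \<ge> s" for y
    using that t by (auto simp: log_excess_def truncated_log_def s_def min_def max_def)
  have inside: "log_excess t y = ln s - ln \<bar>y\<bar>" if "0 < \<bar>y\<bar>" "\<bar>y\<bar> < s" for y
  proof -
    have "min 1 (max \<bar>y\<bar> 0) = \<bar>y\<bar>" "min 1 (max \<bar>y\<bar> t) = s"
      using that t by (auto simp: s_def)
    moreover have "ln \<bar>y\<bar> \<le> ln s" using that by (subst ln_le_cancel_iff) auto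
    ultimately show ?thesis by (simp add: log_excess_def truncated_log_def)
  qed
  have pos: "(log_excess t has_integral s) {0..s}"
    using s by (intro has_integral_ln_ratio) (auto simp: inside)
  have even: "log_excess t (- y) = log_excess t y" for y
    by (simp add: log_excess_def truncated_log_def)
  have "((\<lambda>y. log_excess t (- y)) has_integral s) {-s..0}"
    using pos has_integral_reflect_real[of "log_excess t" s s 0] s by simp
  then have "(log_excess t has_integral s) {-s..0}" by (simp add: even)
  then have "(log_excess t has_integral (s + s)) {-s..s}"
    using pos s by (intro has_integral_combine[of "-s" 0 s]) auto
  then have "(log_excess t has_integral (2 * s)) {-s..s}" by (simp only: mult_2)
  then have "(log_excess t has_integral (2 * s)) UNIV"
  proof (rule has_integral_on_superset)
    show "log_excess t y = 0" if "y \<notin> {-s..s}" for y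
      using that by (intro outside) auto
  qed simp
  then have "(\<integral>\<^sup>+y. ennreal (log_excess t y) \<partial>lborel) = ennreal (2 * s)"
    by (intro nn_integral_has_integral_lborel) (simp_all, simp add: log_excess_def)
  then show ?thesis using s by (auto intro: ennreal_leI)
qed

section \<open>The witness\<close>

definition arch :: "real \<Rightarrow> real" where
  "arch x = frac x * (1 - frac x)"

lemma arch_bounds: "0 \<le> arch x" "arch x \<le> 1"
  using frac_ge_0[of x] frac_lt_1[of x] by (auto simp: arch_def mult_le_one)

lemma arch_le_dist_int: "arch x \<le> \<bar>x - of_int m\<bar>"
proof (cases "of_int m \<le> x")
  case True
  then have "frac x \<le> x - of_int m" by (simp add: frac_def le_floor_iff)
  moreover have "arch x \<le> frac x"
    using frac_ge_0[of x] frac_lt_1[of x] by (auto simp: arch_def mult_left_le)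
  ultimately show ?thesis by linarith
next
  case False
  then have "\<lfloor>x\<rfloor> < m" by (simp add: floor_less_iff)
  then have "\<lfloor>x\<rfloor> + 1 \<le> m" by simp
  then have "real_of_int \<lfloor>x\<rfloor> + 1 \<le> of_int m" by linarith
  then have "1 - frac x \<le> of_int m - x" unfolding frac_def by linarith
  moreover have "arch x \<le> 1 - frac x"
    using frac_ge_0[of x] frac_lt_1[of x] by (auto simp: arch_def mult_left_le_one_le)
  ultimately show ?thesis by linarith
qed

lemma arch_Lipschitz:
  assumes "\<lfloor>x\<rfloor> = \<lfloor>a\<rfloor>"
  shows "\<bar>arch x - arch a\<bar> \<le> \<bar>x - a\<bar>"
proof -
  have "arch x - arch a = (x - a) * (1 - frac x - frac a)"
    using assms by (simp add: arch_def frac_def algebra_simps)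
  then have "\<bar>arch x - arch a\<bar> = \<bar>x - a\<bar> * \<bar>1 - frac x - frac a\<bar>" by (simp add: abs_mult)
  also have "\<dots> \<le> \<bar>x - a\<bar>"
    using frac_ge_0[of x] frac_lt_1[of x] frac_ge_0[of a] frac_lt_1[of a]
    by (intro mult_left_le) (auto simp: abs_le_iff simp del: frac_ge_0)
  finally show ?thesis .
qed

definition ridges :: "(int \<Rightarrow> real) \<Rightarrow> real \<times> real \<Rightarrow> real" where
  "ridges q = (\<lambda>(x, y). arch x * truncated_log 0 (y - q \<lfloor>x\<rfloor>))"

lemma measurable_ridges [measurable]: "ridges q \<in> borel_measurable borel"
  unfolding ridges_def arch_def frac_def borel_prod[symmetric] by measurable

section \<open>Bounded mean oscillation in the plane\<close>

text \<open>In a square inside one strip, \<open>c\<close> is the value at the lower left corner with the logarithm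
  truncated at the scale of the square: truncation changes the logarithm by the excess, moving
  within the square by at most 1, and the variation of \<open>arch\<close> contributes at most 1. If an integer
  lies in the horizontal range, \<open>arch\<close> is at most \<open>t\<close> and the truncated part is absorbed altogether.
  Squares of side at least 1 are included, as the truncated logarithm is then zero.\<close>

lemma ridges_pointwise:
  assumes t: "t > 0"
  obtains c where "\<And>x y. x \<in> {a..a + t} \<Longrightarrow> y \<in> {b..b + t} \<Longrightarrow>
    \<bar>ridges q (x, y) - c\<bar> \<le> 2 + log_excess t (y - q \<lfloor>x\<rfloor>)"
proof (cases "\<lfloor>a + t\<rfloor> = \<lfloor>a\<rfloor>")
  case True
  define r where "r = q \<lfloor>a\<rfloor>"
  define L where "L = truncated_log t (b - r)"
  show ?thesis
  proof (rule that[of "arch a * L"])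
    fix x y assume x: "x \<in> {a..a + t}" and y: "y \<in> {b..b + t}"
    have fl: "\<lfloor>x\<rfloor> = \<lfloor>a\<rfloor>"
      using floor_mono[of a x] floor_mono[of x "a + t"] x True by auto
    have "\<bar>truncated_log t (y - r) - L\<bar> \<le> 1"
      unfolding L_def using t y by (intro truncated_log_variation) auto
    then have "\<bar>truncated_log 0 (y - r) - L\<bar> \<le> log_excess t (y - r) + 1"
      unfolding log_excess_def by linarith
    then have 1: "arch x * \<bar>truncated_log 0 (y - r) - L\<bar> \<le> log_excess t (y - r) + 1"
      using arch_bounds[of x] by (meson abs_ge_zero mult_left_le_one_le order_trans)
    have L: "L \<ge> 0" unfolding L_def using t by (intro truncated_log_nonneg) auto
    have "\<bar>arch x - arch a\<bar> \<le> t" using arch_Lipschitz[OF fl] x by auto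
    then have "\<bar>arch x - arch a\<bar> * L \<le> t * L" using L by (intro mult_right_mono)
    also have "\<dots> \<le> 1" unfolding L_def by (rule mult_truncated_log_le[OF t])
    finally have 2: "\<bar>arch x - arch a\<bar> * L \<le> 1" .
    have "ridges q (x, y) - arch a * L =
        arch x * (truncated_log 0 (y - r) - L) + (arch x - arch a) * L"
      by (simp add: ridges_def fl r_def algebra_simps)
    also have "\<bar>\<dots>\<bar> \<le> arch x * \<bar>truncated_log 0 (y - r) - L\<bar> + \<bar>arch x - arch a\<bar> * L"
      using arch_bounds[of x] L by (intro order_trans[OF abs_triangle_ineq]) (auto simp: abs_mult)
    also have "\<dots> \<le> 2 + log_excess t (y - r)" using 1 2 by linarith
    finally show "\<bar>ridges q (x, y) - arch a * L\<bar> \<le> 2 + log_excess t (y - q \<lfloor>x\<rfloor>)"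
      by (simp add: fl r_def)
  qed
next
  case False
  define m where "m = \<lfloor>a + t\<rfloor>"
  have m: "a \<le> of_int m" "of_int m \<le> a + t"
    using False t floor_mono[of a "a + t"] unfolding m_def by linarith+
  show ?thesis
  proof (rule that[of 0])
    fix x y assume x: "x \<in> {a..a + t}"
    define z where "z = y - q \<lfloor>x\<rfloor>"
    have "arch x \<le> t" using arch_le_dist_int[of x m] m x by auto
    then have "arch x * truncated_log t z \<le> t * truncated_log t z"
      using t by (intro mult_right_mono truncated_log_nonneg) auto
    also have "\<dots> \<le> 1" by (rule mult_truncated_log_le[OF t])
    finally have 1: "arch x * truncated_log t z \<le> 1" .
    have 2: "arch x * log_excess t z \<le> log_excess t z"
      using arch_bounds[of x] by (intro mult_left_le_one_le) (auto simp: log_excess_def)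
    have "arch x * truncated_log 0 z \<le> arch x * (log_excess t z + truncated_log t z)"
      using arch_bounds[of x] by (intro mult_left_mono) (auto simp: log_excess_def)
    also have "\<dots> \<le> 2 + log_excess t z" using 1 2 by (simp add: algebra_simps)
    finally show "\<bar>ridges q (x, y) - 0\<bar> \<le> 2 + log_excess t (y - q \<lfloor>x\<rfloor>)"
      using arch_bounds[of x] truncated_log_nonneg[of 0 z] by (simp add: ridges_def z_def)
  qed
qed

text \<open>By Tonelli's theorem: on each vertical line the pole sits at a single height, whose position does
  not affect the integral.\<close>

lemma log_excess_strip:
  fixes q :: "int \<Rightarrow> real"
  assumes t: "t > 0" and ab: "a \<le> b"
  defines "E \<equiv> \<lambda>(x, y). log_excess t (y - q \<lfloor>x\<rfloor>)"
  shows "set_integrable lborel ({a..b} \<times> UNIV) E"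
    and "(LINT p:{a..b} \<times> UNIV|lborel. E p) \<le> 2 * t * (b - a)"
proof -
  define S where "S = {a..b} \<times> (UNIV :: real set)"
  have S: "S \<in> sets borel" unfolding S_def borel_prod[symmetric] by measurable
  have E [measurable]: "E \<in> borel_measurable borel"
    unfolding E_def borel_prod[symmetric] by measurable
  have E0: "E p \<ge> 0" for p by (auto simp: E_def log_excess_def split: prod.splits)
  have shift: "(\<integral>\<^sup>+y. ennreal (log_excess t (y - r)) \<partial>lborel) \<le> ennreal (2 * t)" for r
    using nn_integral_log_excess[OF t]
      nn_integral_real_affine[of "\<lambda>y. ennreal (log_excess t y)" 1 "- r"] by (simp add: add.commute)
  have "(\<integral>\<^sup>+p. ennreal (indicator S p * E p) \<partial>lborel)
      = (\<integral>\<^sup>+p. ennreal (indicator S p * E p) \<partial>(lborel \<Otimes>\<^sub>M lborel))"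
    by (simp add: lborel_prod)
  also have "\<dots> = (\<integral>\<^sup>+x. \<integral>\<^sup>+y. ennreal (indicator S (x, y) * E (x, y)) \<partial>lborel \<partial>lborel)"
    using S by (intro lborel.nn_integral_fst[symmetric]) (simp add: lborel_prod)
  also have "\<dots> = (\<integral>\<^sup>+x. indicator {a..b} x *
      (\<integral>\<^sup>+y. ennreal (log_excess t (y - q \<lfloor>x\<rfloor>)) \<partial>lborel) \<partial>lborel)"
    by (intro nn_integral_cong) (auto simp: S_def E_def indicator_def)
  also have "\<dots> \<le> (\<integral>\<^sup>+x. ennreal (2 * t) * indicator {a..b} x \<partial>lborel)"
    by (intro nn_integral_mono) (auto simp: indicator_def shift)
  also have "\<dots> = ennreal (2 * t * (b - a))"
    using t ab by (simp add: nn_integral_cmult_indicator ennreal_mult)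
  finally have bound: "(\<integral>\<^sup>+p. ennreal (indicator S p * E p) \<partial>lborel) \<le> ennreal (2 * t * (b - a))" .
  show int: "set_integrable lborel ({a..b} \<times> UNIV) E"
    unfolding set_integrable_def S_def[symmetric]
    using S bound E0
    by (intro integrableI_nonneg) (auto simp: less_top[symmetric] top_unique)
  have "ennreal (LINT p:S|lborel. E p) = (\<integral>\<^sup>+p. ennreal (indicator S p * E p) \<partial>lborel)"
    unfolding set_lebesgue_integral_def
    using int E0 by (subst nn_integral_eq_integral) (auto simp: set_integrable_def S_def)
  with bound have "ennreal (LINT p:S|lborel. E p) \<le> ennreal (2 * t * (b - a))" by simp
  then show "(LINT p:{a..b} \<times> UNIV|lborel. E p) \<le> 2 * t * (b - a)"
    using t ab unfolding S_def by (subst (asm) ennreal_le_iff) auto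
qed

text \<open>Since the logarithm truncated at distance 1 is zero, \<open>log_excess 1\<close> dominates the witness
  everywhere, and it is integrable over vertical strips.\<close>

lemma set_integrable_ridges:
  assumes "compact K"
  shows "set_integrable lebesgue K (ridges q)"
proof -
  have "bounded (fst ` K)" using assms by (simp add: compact_imp_bounded bounded_fst)
  then obtain a b where ab: "fst ` K \<subseteq> {a..b}"
    by (metis bounded_subset_cbox_symmetric cbox_interval)
  define b' where "b' = max a b"
  have K: "K \<subseteq> {a..b'} \<times> UNIV" using ab by (force simp: b'_def)
  have Kb: "K \<in> sets lborel" using assms by (simp add: borel_compact)
  have *: "set_integrable lborel ({a..b'} \<times> UNIV) (\<lambda>(x, y). log_excess 1 (y - q \<lfloor>x\<rfloor>))"
    by (intro log_excess_strip) (auto simp: b'_def)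
  have "set_integrable lborel K (\<lambda>(x, y). log_excess 1 (y - q \<lfloor>x\<rfloor>))"
    by (rule set_integrable_subset[OF * Kb K])
  then have "set_integrable lborel K (ridges q)"
  proof (rule set_integrable_bound)
    show "set_borel_measurable lborel K (ridges q)"
      using Kb unfolding set_borel_measurable_def by measurable
    have "\<bar>ridges q p\<bar> \<le> \<bar>(\<lambda>(x, y). log_excess 1 (y - q \<lfloor>x\<rfloor>)) p\<bar>" for p
    proof (cases p)
      case (Pair x y)
      have "truncated_log 1 (y - q \<lfloor>x\<rfloor>) = 0" by (simp add: truncated_log_def)
      then show ?thesis
        using arch_bounds[of x] truncated_log_nonneg[of 0 "y - q \<lfloor>x\<rfloor>"]
        by (simp add: Pair ridges_def log_excess_def mult_left_le_one_le)
    qed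
    then show "AE p in lborel. p \<in> K \<longrightarrow>
        norm (ridges q p) \<le> norm ((\<lambda>(x, y). log_excess 1 (y - q \<lfloor>x\<rfloor>)) p)" by simp
  qed
  then show ?thesis
    unfolding set_integrable_def
    using Kb by (subst integrable_completion) auto
qed

lemma closed_cubes_plane:
  assumes "Q \<in> (closed_cubes :: (real \<times> real) set set)"
  obtains a b t where "t > 0" "Q = {a..a + t} \<times> {b..b + t}"
proof -
  obtain p t where t: "t > 0" and Q: "Q = cbox p (p + t *\<^sub>R One)"
    using assms by (auto simp: closed_cubes_def)
  obtain a b where p: "p = (a, b)" by fastforce
  have "(One :: real \<times> real) = (1, 1)"
    by (simp add: Basis_prod_def sum.union_disjoint prod_eq_iff) 
  then have "Q = {a..a + t} \<times> {b..b + t}"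
    by (simp add: Q p cbox_Pair_eq)
  with t that show ?thesis by blast
qed

text \<open>The pointwise bound has mean at most \<open>2 + 2\<close> over the square, and passing from \<open>c\<close> to the average
  doubles this.\<close>

lemma mean_oscillation_ridges:
  assumes "Q \<in> closed_cubes"
  shows "mean_oscillation (ridges q) Q \<le> 8"
proof -
  obtain a b t where t: "t > 0" and Q: "Q = {a..a + t} \<times> {b..b + t}"
    using closed_cubes_plane[OF assms] .
  obtain c where c: "\<And>x y. x \<in> {a..a + t} \<Longrightarrow> y \<in> {b..b + t} \<Longrightarrow>
      \<bar>ridges q (x, y) - c\<bar> \<le> 2 + log_excess t (y - q \<lfloor>x\<rfloor>)"
    using ridges_pointwise[OF t, of a b q] by blast
  define E :: "real \<times> real \<Rightarrow> real" where "E = (\<lambda>(x, y). log_excess t (y - q \<lfloor>x\<rfloor>))"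
  have Qbox: "Q = cbox (a, b) (a + t, b + t)" by (simp add: Q cbox_Pair_eq)
  have Qm: "Q \<in> lmeasurable" unfolding Qbox by (rule lmeasurable_cbox)
  have Qs: "Q \<in> sets lborel" unfolding Qbox by simp
  have mQ: "measure lebesgue Q = t * t"
    using t by (simp add: Qbox measure_completion content_Pair)
  have E: "set_integrable lborel ({a..a + t} \<times> UNIV) E"
    and intE: "(LINT p:{a..a + t} \<times> UNIV|lborel. E p) \<le> 2 * t * (a + t - a)"
    unfolding E_def using log_excess_strip[OF t, of a "a + t" q] t by auto
  have QS: "Q \<subseteq> {a..a + t} \<times> UNIV" by (auto simp: Q)
  have EQ': "set_integrable lborel Q E" by (rule set_integrable_subset[OF E Qs QS])
  have EQ: "set_integrable lebesgue Q E"
    using EQ' unfolding set_integrable_def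
    by (subst integrable_completion) (auto simp: borel_measurable_integrable)
  have "(LINT p:Q|lebesgue. E p) = (LINT p:Q|lborel. E p)"
    using EQ' unfolding set_integrable_def set_lebesgue_integral_def
    by (intro integral_completion) (auto simp: borel_measurable_integrable)
  also have "\<dots> \<le> (LINT p:{a..a + t} \<times> UNIV|lborel. E p)"
    unfolding set_lebesgue_integral_def
    using E EQ' QS
    by (intro integral_mono)
      (auto simp: set_integrable_def indicator_def E_def log_excess_def split: prod.splits)
  also have "\<dots> \<le> 2 * (t * t)" using intE by simp
  finally have intEQ: "(LINT p:Q|lebesgue. E p) \<le> 2 * (t * t)" .
  have const: "set_integrable lebesgue Q (\<lambda>p. k)" for k :: real
    using Qm by (simp add: set_integrable_def lmeasurable_iff_integrable)
  have ri: "set_integrable lebesgue Q (ridges q)"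
    unfolding Qbox by (intro set_integrable_ridges compact_cbox)
  have "(LINT p:Q|lebesgue. \<bar>ridges q p - c\<bar>) \<le> (LINT p:Q|lebesgue. 2 + E p)"
    using c by (intro set_integral_mono set_integrable_abs set_integral_diff set_integral_add ri const EQ)
      (auto simp: Q E_def)
  also have "\<dots> = 2 * (t * t) + (LINT p:Q|lebesgue. E p)"
    using Qm mQ
    by (simp add: set_integral_add const EQ)
      (simp add: set_lebesgue_integral_def lmeasurable_iff_integrable)
  also have "\<dots> \<le> 4 * (t * t)" using intEQ by simp
  finally have "average (\<lambda>p. \<bar>ridges q p - c\<bar>) Q \<le> 4"
    using t by (simp add: average_def mQ divide_simps)
  moreover have "mean_oscillation (ridges q) Q \<le> 2 * average (\<lambda>p. \<bar>ridges q p - c\<bar>) Q"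
    using t by (intro mean_oscillation_le ri Qm) (simp add: mQ)
  ultimately show ?thesis by linarith
qed

lemma ridges_in_BMO: "ridges q \<in> BMO"
proof -
  have "bmo_norm (ridges q) \<le> ereal 8"
    unfolding bmo_norm_def by (intro SUP_least) (simp add: mean_oscillation_ridges)
  then have "bmo_norm (ridges q) < \<infinity>" by (rule order_le_less_trans) simp
  then show ?thesis by (simp add: BMO_def locally_integrable_def set_integrable_ridges)
qed

section \<open>Unbounded mean oscillation of the slices\<close>

text \<open>The profile \<open>u * (1 - u)\<close> has mean \<open>1 / 6\<close> and variance \<open>1 / 180\<close> on the unit interval. The variance
  is a lower bound for the oscillation because the deviation from the mean is at most 1.\<close>

lemma mean_oscillation_ridges_slice:
  "mean_oscillation (\<lambda>x. ridges q (x, y)) {of_int n..of_int n + 1}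
    \<ge> truncated_log 0 (y - q n) / 180"
proof -
  define I where "I = {of_int n..of_int n + 1 :: real}"
  define l where "l = truncated_log 0 (y - q n)"
  define p where "p = (\<lambda>x::real. (x - n) * (1 - (x - n)))"
  have l: "l \<ge> 0" unfolding l_def by (rule truncated_log_nonneg) simp
  have mI: "measure lebesgue I = 1" by (simp add: I_def)
  have I: "I \<in> sets lebesgue" by (simp add: I_def)
  \<comment> \<open>At the right endpoint the floor selects the next strip, but both sides vanish there.\<close>
  have slice: "ridges q (x, y) = l * p x" if "x \<in> I" for x
  proof (cases "x = of_int n + 1")
    case True
    then have "frac x = 0" by (simp add: frac_eq_0_iff)
    then show ?thesis using True by (simp add: ridges_def arch_def p_def)
  next
    case False
    then have "\<lfloor>x\<rfloor> = n" using that by (auto simp: I_def floor_eq_iff)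
    then show ?thesis by (simp add: ridges_def arch_def p_def l_def frac_def)
  qed
  have int: "set_integrable lebesgue I f" if "continuous_on I f" for f :: "real \<Rightarrow> real"
    using that unfolding I_def by (rule absolutely_integrable_continuous_real)
  have FTC: "(LINT x:I|lebesgue. f x) = F (of_int n + 1) - F (of_int n)"
    if "continuous_on I f" "\<And>x. (F has_real_derivative f x) (at x)" for f F :: "real \<Rightarrow> real"
  proof -
    have "(f has_integral (F (of_int n + 1) - F (of_int n))) I"
      unfolding I_def using that(2)
      by (intro fundamental_theorem_of_calculus)
        (auto simp: has_real_derivative_iff_has_vector_derivative[symmetric]
          intro: DERIV_subset)
    then show ?thesis
      using set_lebesgue_integral_eq_integral(2)[OF int[OF that(1)]] by (simp add: integral_unique)
  qed
  have contp: "continuous_on I p" unfolding p_def by (intro continuous_intros)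
  have "(LINT x:I|lebesgue. p x) = 1 / 6"
    by (subst FTC[of _ "\<lambda>x. (x - n)^2 / 2 - (x - n)^3 / 3", OF contp])
      (auto simp: p_def field_simps power2_eq_square intro!: derivative_eq_intros)
  then have avg: "average (\<lambda>x. ridges q (x, y)) I = l / 6"
    unfolding average_def mI
    by (subst set_lebesgue_integral_cong[where g = "\<lambda>x. l * p x", OF I]) (auto simp: slice)
  have "(LINT x:I|lebesgue. (p x - 1 / 6)^2) = 1 / 180"
    by (subst FTC[of _ "\<lambda>x. (x - n)^3 / 3 - (x - n)^4 / 2 + (x - n)^5 / 5
        - (x - n)^2 / 6 + (x - n)^3 / 9 + (x - n) / 36"])
      (auto simp: p_def field_simps power2_eq_square power3_eq_cube power4_eq_xxxx
        intro!: derivative_eq_intros continuous_intros)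
  moreover have "(p x - 1 / 6)^2 \<le> \<bar>p x - 1 / 6\<bar>" if "x \<in> I" for x
  proof -
    have "0 \<le> p x" "p x \<le> 1"
      using that by (auto simp: p_def I_def intro!: mult_nonneg_nonneg mult_le_one)
    then have "\<bar>p x - 1 / 6\<bar> \<le> 1" by linarith
    then have "\<bar>p x - 1 / 6\<bar> * \<bar>p x - 1 / 6\<bar> \<le> \<bar>p x - 1 / 6\<bar>" by (intro mult_left_le) auto
    then show ?thesis by (simp add: power2_eq_square)
  qed
  then have "(LINT x:I|lebesgue. (p x - 1 / 6)^2) \<le> (LINT x:I|lebesgue. \<bar>p x - 1 / 6\<bar>)"
    by (intro set_integral_mono int continuous_intros contp) auto
  ultimately have "l * (1 / 180) \<le> l * (LINT x:I|lebesgue. \<bar>p x - 1 / 6\<bar>)"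
    using l by (intro mult_left_mono) auto
  also have "\<dots> = (LINT x:I|lebesgue. \<bar>ridges q (x, y) - l / 6\<bar>)"
  proof -
    have "\<bar>l * p x - l / 6\<bar> = l * \<bar>p x - 1 / 6\<bar>" for x
    proof -
      have "l * p x - l / 6 = l * (p x - 1 / 6)" by (simp add: algebra_simps)
      then show ?thesis using l by (simp only: abs_mult abs_of_nonneg)
    qed
    then show ?thesis
      by (subst (2) set_lebesgue_integral_cong[where g = "\<lambda>x. l * \<bar>p x - 1 / 6\<bar>", OF I])
        (auto simp: slice)
  qed
  also have "\<dots> = mean_oscillation (\<lambda>x. ridges q (x, y)) I"
    by (simp add: mean_oscillation_def avg average_def[of _ I] mI)
  finally show ?thesis by (simp add: I_def l_def)
qed

text \<open>A rational \<open>r\<close> with \<open>y < r\<close> is chosen close to \<open>y\<close>; the strict inequality matters, since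
  the slice through the ridge itself is zero on that strip.\<close>

lemma ridges_slice_not_BMO:
  assumes "\<rat> \<subseteq> range q"
  shows "(\<lambda>x. ridges q (x, y)) \<notin> BMO"
proof
  assume "(\<lambda>x. ridges q (x, y)) \<in> BMO"
  then have "bmo_norm (\<lambda>x. ridges q (x, y)) < \<infinity>" by (simp add: BMO_def)
  then obtain M where M: "bmo_norm (\<lambda>x. ridges q (x, y)) < ereal M"
    using less_PInf_Ex_of_nat[of "bmo_norm (\<lambda>x. ridges q (x, y))"] by fastforce
  define B where "B = max 0 (180 * M)"
  obtain r where r: "r \<in> \<rat>" "y < r" "r < y + exp (- B)"
    using Rats_dense_in_real[of y "y + exp (- B)"] by auto
  obtain n where n: "q n = r" using assms r(1) by (metis imageE subsetD)
  have e: "exp (- B) \<le> 1" by (simp add: B_def)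
  have d: "\<bar>y - r\<bar> = r - y" "0 < r - y" "r - y < exp (- B)" using r by auto
  then have "ln (r - y) \<le> ln (exp (- B))" by (subst ln_le_cancel_iff) auto
  moreover have "truncated_log 0 (y - r) = - ln (r - y)"
  proof -
    have "min 1 (max \<bar>y - r\<bar> 0) = r - y" using d e by linarith
    then show ?thesis by (simp only: truncated_log_def)
  qed
  ultimately have "M \<le> truncated_log 0 (y - q n) / 180" by (simp add: n B_def)
  also have "\<dots> \<le> mean_oscillation (\<lambda>x. ridges q (x, y)) {of_int n..of_int n + 1}"
    by (rule mean_oscillation_ridges_slice)
  finally have "ereal M \<le> ereal \<dots>" by simp
  also have "\<dots> \<le> bmo_norm (\<lambda>x. ridges q (x, y))"
  proof -
    have "{of_int n..of_int n + 1 :: real} \<in> closed_cubes"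
      unfolding closed_cubes_def by (auto intro!: exI[of _ "of_int n"] exI[of _ 1])
    then show ?thesis unfolding bmo_norm_def by (rule SUP_upper)
  qed
  finally show False using M by simp
qed

theorem mainTheorem6:
  "\<exists>h \<in> (BMO :: (real \<times> real \<Rightarrow> real) set).
     \<forall>y::real. (\<lambda>x::real. h (x, y)) \<notin> (BMO :: (real \<Rightarrow> real) set)"
proof -
  define q :: "int \<Rightarrow> real" where "q = (\<lambda>n. from_nat_into \<rat> (nat n))"
  have "\<rat> \<subseteq> range q"
  proof
    fix r :: real assume "r \<in> \<rat>"
    then obtain k where "from_nat_into \<rat> k = r"
      using from_nat_into_surj[OF countable_rat] by blast
    then have "r = q (int k)" by (simp add: q_def)
    then show "r \<in> range q" by blast
  qed
  then show ?thesis using ridges_in_BMO ridges_slice_not_BMO by blast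
qed

end
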